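(* On functions of $x$ and $\alpha$ define the operators $\lambda_\alpha\{f(\alpha)\}=f(\alpha+1)$ (shift in the parameter $\alpha$), $\eta_x\{f(x)\}=f(qx)$, and $$\Delta_{x,\alpha}=\eta_x-\frac{xq^{\alpha+1}}{1-q^{\alpha+1}}\,\lambda_\alpha\eta_x .$$ Then for every integer $n\ge 0$ and $\alpha>-1$, $$\Delta_{x,\alpha}^n\{1\}=L_n^{(\alpha)}(x).$$
   Context: Fix $q$ with $0<|q|<1$; real powers $q^{s}$ are taken with respect to a fixed choice of $\log q$. $(a;q)_0=1$, $(a;q)_n=\prod_{i=0}^{n-1}(1-aq^i)$, $\begin{bmatrix} n\\ k\end{bmatrix}=\frac{(q;q)_n}{(q;q)_k(q;q)_{n-k}}$. Here $$L_n^{(\alpha)}(x)=\sum_{k=0}^n\begin{bmatrix} n\\ k\end{bmatrix}\frac{q^{k^2+k\alpha}}{(q^{\alpha+1};q)_k}(-x)^k .$$ In $\Delta_{x,\alpha}$, $\frac{xq^{\alpha+1}}{1-q^{\alpha+1}}$ acts as multiplication, applied after $\lambda_\alpha\eta_x$; explicitly $\Delta_{x,\alpha}\{f\}(x,\alpha)=f(qx,\alpha)-\frac{xq^{\alpha+1}}{1-q^{\alpha+1}}f(qx,\alpha+1)$. $\Delta_{x,\alpha}^n$ is the $n$-fold composition, and $1$ is the constant function. *)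

theory Defs
  imports Complex_Main
begin

text \<open>
  The power \<open>q\<^sup>s\<close> for real \<open>s\<close>, relative to a chosen logarithm \<open>logq\<close> of \<open>q\<close>, i.e. any complex
  number with \<open>exp logq = q\<close>; this is not necessarily the principal logarithm, which is why
  \<open>powr\<close> is not used.
\<close>
definition q_power :: "complex \<Rightarrow> real \<Rightarrow> complex" where
  "q_power logq s = exp (of_real s * logq)"

definition q_pochhammer :: "complex \<Rightarrow> complex \<Rightarrow> nat \<Rightarrow> complex" where
  "q_pochhammer a q n = (\<Prod>i<n. 1 - a * q ^ i)"

text \<open>Meant for \<open>k \<le> n\<close> only (\<open>n - k\<close> is truncated subtraction).\<close>
definition q_binomial :: "complex \<Rightarrow> nat \<Rightarrow> nat \<Rightarrow> complex" where
  "q_binomial q n k = q_pochhammer q q n / (q_pochhammer q q k * q_pochhammer q q (n - k))"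

definition q_laguerre :: "complex \<Rightarrow> complex \<Rightarrow> nat \<Rightarrow> real \<Rightarrow> complex \<Rightarrow> complex" where
  "q_laguerre q logq n \<alpha> x =
     (\<Sum>k\<le>n. q_binomial q n k
        * (q_power logq (real k ^ 2 + real k * \<alpha>) / q_pochhammer (q_power logq (\<alpha> + 1)) q k)
        * (- x) ^ k)"

text \<open>
  Functions of \<open>x\<close> and \<open>\<alpha>\<close> are total functions of type \<^typ>\<open>complex \<Rightarrow> real \<Rightarrow> complex\<close>. The
  operators below only ever move \<open>\<alpha>\<close> to \<open>\<alpha> + 1\<close>, so the results at \<open>\<alpha> > -1\<close> do not depend on
  the values of the function elsewhere.
\<close>
definition shift_param :: "(complex \<Rightarrow> real \<Rightarrow> complex) \<Rightarrow> complex \<Rightarrow> real \<Rightarrow> complex" where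
  "shift_param f = (\<lambda>x \<alpha>. f x (\<alpha> + 1))"

definition q_dilation ::
    "complex \<Rightarrow> (complex \<Rightarrow> real \<Rightarrow> complex) \<Rightarrow> complex \<Rightarrow> real \<Rightarrow> complex" where
  "q_dilation q f = (\<lambda>x \<alpha>. f (q * x) \<alpha>)"

definition Delta_op ::
    "complex \<Rightarrow> complex \<Rightarrow> (complex \<Rightarrow> real \<Rightarrow> complex) \<Rightarrow> complex \<Rightarrow> real \<Rightarrow> complex" where
  "Delta_op q logq f = (\<lambda>x \<alpha>. q_dilation q f x \<alpha>
     - x * q_power logq (\<alpha> + 1) / (1 - q_power logq (\<alpha> + 1))
       * shift_param (q_dilation q f) x \<alpha>)"

end

theory Submission
  imports Defs
begin

text \<open>
  Write \<open>L\<^sub>n\<^sup>\<alpha>(x) = \<Sum>k. [n, k] t\<^sub>k\<^sup>\<alpha>(x)\<close>. The dilation multiplies \<open>t\<^sub>k\<^sup>\<alpha>\<close> by \<open>q\<^sup>k\<close>, while the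
  second summand of the operator maps the family \<open>t\<^sub>k\<close> to \<open>t\<^sub>k\<^sub>+\<^sub>1\<close>; comparing coefficients, one
  application of the operator raises \<open>n\<close> by one because of the \<open>q\<close>-Pascal rule
  \<open>[n+1, k+1] = [n, k] + q\<^sup>k\<^sup>+\<^sup>1 [n, k+1]\<close>.
\<close>

lemma q_power_add: "q_power l (s + t) = q_power l s * q_power l t"
  by (simp add: q_power_def ring_distribs exp_add)

lemma q_power_of_nat: "q_power l (real k) = exp l ^ k"
  by (simp add: q_power_def exp_of_nat_mult)

lemma q_pochhammer_0 [simp]: "q_pochhammer a q 0 = 1"
  by (simp add: q_pochhammer_def)

lemma q_pochhammer_Suc: "q_pochhammer a q (Suc n) = q_pochhammer a q n * (1 - a * q ^ n)"
  by (simp add: q_pochhammer_def)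

text \<open>Splitting off the first factor instead of the last moves the base from \<open>a\<close>
  to \<open>a * q\<close>; with \<open>a\<close> = q^(\<alpha>+1) this is the parameter shift
  \<alpha> to \<alpha> + 1.\<close>

lemma q_pochhammer_Suc_shift:
  "q_pochhammer a q (Suc n) = (1 - a) * q_pochhammer (a * q) q n"
  unfolding q_pochhammer_def prod.lessThan_Suc_shift by (simp add: mult.assoc)

text \<open>Each factor is 1 - q^(i+1), and |q^(i+1)| < 1 keeps it away from 0.\<close>

lemma q_pochhammer_self_nonzero:
  assumes "norm q < 1"
  shows "q_pochhammer q q n \<noteq> 0"
proof -
  have "q * q ^ i \<noteq> 1" for i
  proof
    assume "q * q ^ i = 1"
    then have "norm q ^ Suc i = 1"
      by (metis norm_one norm_power power_Suc)
    moreover have "norm q ^ Suc i < 1"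
      using assms power_Suc_less_one by (metis norm_ge_zero power_less_one_iff zero_less_Suc)
    ultimately show False by simp
  qed
  then show ?thesis
    by (auto simp: q_pochhammer_def)
qed

lemma q_binomial_0_right [simp]:
  assumes "norm q < 1"
  shows "q_binomial q n 0 = 1"
  using q_pochhammer_self_nonzero[OF assms] by (simp add: q_binomial_def)

lemma q_binomial_self [simp]:
  assumes "norm q < 1"
  shows "q_binomial q n n = 1"
  using q_pochhammer_self_nonzero[OF assms] by (simp add: q_binomial_def)

text \<open>The bound \<open>j < n\<close> matters: at \<open>j = n\<close> truncated subtraction
  gives \<open>q_binomial q n (Suc n)\<close> a nonzero value instead of the conventional 0.\<close>

lemma q_binomial_Suc_Suc:
  assumes "norm q < 1" "j < n"
  shows "q_binomial q (Suc n) (Suc j) = q_binomial q n j + q ^ Suc j * q_binomial q n (Suc j)"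
proof -
  \<comment> \<open>Here \<open>m\<close> is n - j - 1, so the differences n - j and n - (j + 1)
    become \<open>Suc m\<close> and \<open>m\<close>.\<close>
  obtain m where n: "n = Suc (j + m)"
    using assms(2) less_imp_Suc_add by blast
  define P where "P = q_pochhammer q q"
  have nz: "P k \<noteq> 0" for k
    unfolding P_def by (rule q_pochhammer_self_nonzero[OF assms(1)])
  have P: "P (Suc k) = P k * (1 - q ^ Suc k)" for k
    by (simp add: P_def q_pochhammer_Suc)
  have nz': "1 - q ^ Suc k \<noteq> 0" for k
    using nz[of "Suc k"] P by auto
  have "q_binomial q (Suc n) (Suc j) = P n * (1 - q ^ Suc n) / (P (Suc j) * P (Suc m))"
    unfolding q_binomial_def P_def [symmetric] P [of n, symmetric] by (simp add: n)
  \<comment> \<open>Each summand of this splitting cancels the last factor of one Pochhammer symbol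
    in the denominator.\<close>
  also have "1 - q ^ Suc n = (1 - q ^ Suc j) + q ^ Suc j * (1 - q ^ Suc m)"
    by (simp add: n power_add algebra_simps)
  also have "P n * \<dots> / (P (Suc j) * P (Suc m)) =
      P n * (1 - q ^ Suc j) / (P (Suc j) * P (Suc m))
      + q ^ Suc j * (P n * (1 - q ^ Suc m) / (P (Suc j) * P (Suc m)))"
    by (simp only: distrib_left add_divide_distrib times_divide_eq_right mult_ac)
  also have "P n * (1 - q ^ Suc j) / (P (Suc j) * P (Suc m)) = P n / (P j * P (Suc m))"
    using nz nz'[of j] unfolding P[of j] by (simp del: power_Suc)
  also have "P n * (1 - q ^ Suc m) / (P (Suc j) * P (Suc m)) = P n / (P (Suc j) * P m)"
    using nz nz'[of m] unfolding P[of m] by (simp del: power_Suc)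
  finally show ?thesis
    by (simp add: q_binomial_def n P_def Suc_diff_le)
qed

definition q_laguerre_term :: "complex \<Rightarrow> complex \<Rightarrow> nat \<Rightarrow> real \<Rightarrow> complex \<Rightarrow> complex" where
  "q_laguerre_term q logq k \<alpha> x =
     q_power logq (real k ^ 2 + real k * \<alpha>) / q_pochhammer (q_power logq (\<alpha> + 1)) q k * (- x) ^ k"

lemma q_laguerre_eq_sum_term:
  "q_laguerre q logq n \<alpha> x = (\<Sum>k\<le>n. q_binomial q n k * q_laguerre_term q logq k \<alpha> x)"
  by (simp add: q_laguerre_def q_laguerre_term_def mult.assoc)

lemma q_laguerre_term_0 [simp]: "q_laguerre_term q logq 0 \<alpha> x = 1"
  by (simp add: q_laguerre_term_def q_power_def)

lemma q_laguerre_term_dilation: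
  "q_laguerre_term q logq k \<alpha> (q * x) = q ^ k * q_laguerre_term q logq k \<alpha> x"
proof -
  have "(- (q * x)) ^ k = q ^ k * (- x) ^ k"
    by (metis mult_minus_right power_mult_distrib)
  then show ?thesis
    by (simp add: q_laguerre_term_def)
qed

text \<open>The exponent splits as (k+1)^2 + (k+1)\<alpha> = (\<alpha>+1) + (k^2 + k(\<alpha>+1)) +
  k. The first part and the first Pochhammer factor form the multiplier of the operator, the middle
  part belongs to the term at \<alpha> + 1, and q^k comes from the dilation.\<close>

lemma q_laguerre_term_Suc:
  assumes "exp logq = q"
  shows "q_laguerre_term q logq (Suc k) \<alpha> x =
    - (x * q_power logq (\<alpha> + 1) / (1 - q_power logq (\<alpha> + 1))
        * q_laguerre_term q logq k (\<alpha> + 1) (q * x))"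
proof -
  define a where "a = q_power logq (\<alpha> + 1)"
  have a': "q_power logq (\<alpha> + 1 + 1) = a * q"
    using q_power_of_nat[of logq 1] assms by (simp only: a_def q_power_add[of logq "\<alpha> + 1"]) simp
  have "real (Suc k) ^ 2 + real (Suc k) * \<alpha> = (\<alpha> + 1) + (real k ^ 2 + real k * (\<alpha> + 1)) + real k"
    by (simp add: power2_eq_square algebra_simps)
  then have "q_power logq (real (Suc k) ^ 2 + real (Suc k) * \<alpha>)
      = a * q_power logq (real k ^ 2 + real k * (\<alpha> + 1)) * q ^ k"
    by (simp only: q_power_add[of logq _ "real k"] q_power_add[of logq "\<alpha> + 1"]
        q_power_of_nat assms a_def)
  then have "q_laguerre_term q logq (Suc k) \<alpha> x =
      a * q_power logq (real k ^ 2 + real k * (\<alpha> + 1)) * q ^ k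
      / ((1 - a) * q_pochhammer (a * q) q k) * (- x) ^ Suc k"
    by (simp only: q_laguerre_term_def a_def [symmetric] q_pochhammer_Suc_shift)
  then show ?thesis
    unfolding q_laguerre_term_dilation
    unfolding q_laguerre_term_def a' a_def [symmetric] by simp
qed

lemma Delta_op_q_laguerre:
  assumes "norm q < 1" "exp logq = q"
  shows "Delta_op q logq (\<lambda>x \<alpha>. q_laguerre q logq n \<alpha> x) x \<alpha> = q_laguerre q logq (Suc n) \<alpha> x"
proof -
  let ?B = "q_binomial q"
  define t where "t k = q_laguerre_term q logq k \<alpha> x" for k
  have "Delta_op q logq (\<lambda>x \<alpha>. q_laguerre q logq n \<alpha> x) x \<alpha> =
      (\<Sum>k\<le>n. ?B n k * (q ^ k * t k)) + (\<Sum>k\<le>n. ?B n k * t (Suc k))"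
    unfolding Delta_op_def q_dilation_def shift_param_def q_laguerre_eq_sum_term t_def
      q_laguerre_term_Suc[OF assms(2)]
    by (simp add: q_laguerre_term_dilation sum_distrib_left sum_negf mult_ac)
  \<comment> \<open>The term k = 0 is split off and the rest reindexed by k = j + 1, to match the
    other sum.\<close>
  also have "(\<Sum>k\<le>n. ?B n k * (q ^ k * t k)) =
      1 + (\<Sum>j<n. q ^ Suc j * ?B n (Suc j) * t (Suc j))"
    unfolding lessThan_Suc_atMost [symmetric] sum.lessThan_Suc_shift
    using assms(1) by (simp add: t_def mult_ac)
  \<comment> \<open>The top term k = n is kept apart, leaving the range j < n of the Pascal
    rule.\<close>
  also have "(\<Sum>k\<le>n. ?B n k * t (Suc k)) = (\<Sum>j<n. ?B n j * t (Suc j)) + t (Suc n)"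
    unfolding lessThan_Suc_atMost [symmetric] using assms(1) by simp
  also have "1 + (\<Sum>j<n. q ^ Suc j * ?B n (Suc j) * t (Suc j))
        + ((\<Sum>j<n. ?B n j * t (Suc j)) + t (Suc n)) =
      1 + (\<Sum>j<n. ?B (Suc n) (Suc j) * t (Suc j)) + t (Suc n)"
    using assms(1) by (simp add: q_binomial_Suc_Suc distrib_right sum.distrib)
  \<comment> \<open>The two isolated terms are the ends k = 0 and k = n + 1, where the coefficient
    is 1.\<close>
  also have "\<dots> = (\<Sum>k\<le>Suc n. ?B (Suc n) k * t k)"
    unfolding sum.atMost_Suc_shift
    unfolding lessThan_Suc_atMost [symmetric] sum.lessThan_Suc
    using assms(1) by (simp add: t_def)
  finally show ?thesis
    by (simp add: q_laguerre_eq_sum_term t_def)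
qed

theorem proposition6p1:
  fixes q logq x :: complex and \<alpha> :: real and n :: nat
  assumes "0 < norm q" and "norm q < 1"
    and "exp logq = q"
    and "\<alpha> > -1"
  shows "(Delta_op q logq ^^ n) (\<lambda>x \<alpha>. 1) x \<alpha> = q_laguerre q logq n \<alpha> x"
proof -
  \<comment> \<open>The induction runs over equality of functions, since the operator evaluates its
    argument at \<open>q * x\<close> and at \<alpha> + 1.\<close>
  have "(Delta_op q logq ^^ n) (\<lambda>x \<alpha>. 1) = (\<lambda>x \<alpha>. q_laguerre q logq n \<alpha> x)"
  proof (induction n)
    case 0
    show ?case
      using assms(2) by (simp add: q_laguerre_eq_sum_term)
  next
    case (Suc n)
    then show ?case
      using Delta_op_q_laguerre[OF assms(2,3)] by (intro ext) simp
  qed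
  then show ?thesis
    by simp
qed

end
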